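(* Let $G$ be a finite group acting by simplicial automorphisms on a locally finite weakly systolic complex $\mathbf X$. Then there exists a (nonempty) simplex $\sigma\in\mathbf X$ which is invariant under the action of $G$, i.e. $g\sigma=\sigma$ for all $g\in G$.
   Context: All simplicial complexes are nonempty and flag (every set of vertices, each pair of which lies in a common simplex, is contained in a simplex) with connected $1$-skeleton. Distances, balls $B_r(v)$ and spheres $S_r(v)$ in $\mathbf X$ are those of its $1$-skeleton with the path metric. A flag complex $\mathbf X$ is weakly systolic if for every vertex $v$, every integer $i\ge 0$ and every nonempty simplex $\sigma$ with all vertices in $S_{i+1}(v)$, the set of vertices of $B_i(v)$ adjacent to all vertices of $\sigma$ spans a nonempty simplex. *)

theory Defs
  imports "HOL-Algebra.Group_Action"
begin

text \<open>
  Abstract simplicial complexes are represented by their set of simplices. The empty set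
  counts as a simplex, so nonempty simplices are always required explicitly, and a complex is
  nonempty if it has a vertex. The vertices are exactly the elements of simplices.
\<close>

definition abstract_simplicial_complex :: "'a set set \<Rightarrow> bool" where
  "abstract_simplicial_complex K \<longleftrightarrow>
     (\<forall>\<sigma>\<in>K. finite \<sigma>) \<and> (\<forall>\<sigma>\<in>K. \<forall>\<tau>. \<tau> \<subseteq> \<sigma> \<longrightarrow> \<tau> \<in> K)"

definition sc_vertices :: "'a set set \<Rightarrow> 'a set" where
  "sc_vertices K = \<Union>K"

definition is_flag :: "'a set set \<Rightarrow> bool" where
  "is_flag K \<longleftrightarrow>
     (\<forall>A. A \<subseteq> sc_vertices K \<and> (\<forall>x\<in>A. \<forall>y\<in>A. \<exists>\<sigma>\<in>K. x \<in> \<sigma> \<and> y \<in> \<sigma>)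
          \<longrightarrow> (\<exists>\<sigma>\<in>K. A \<subseteq> \<sigma>))"

definition skel_edges :: "'a set set \<Rightarrow> ('a \<times> 'a) set" where
  "skel_edges K = {(u, v). u \<noteq> v \<and> {u, v} \<in> K}"

definition skel_connected :: "'a set set \<Rightarrow> bool" where
  "skel_connected K \<longleftrightarrow>
     (\<forall>u\<in>sc_vertices K. \<forall>v\<in>sc_vertices K. (u, v) \<in> (skel_edges K)\<^sup>*)"

text \<open>
  The length of a shortest edge path; meaningful only for vertices in the same component of the
  1-skeleton.
\<close>

definition skel_dist :: "'a set set \<Rightarrow> 'a \<Rightarrow> 'a \<Rightarrow> nat" where
  "skel_dist K u v = (LEAST n. (u, v) \<in> skel_edges K ^^ n)"

definition skel_ball :: "'a set set \<Rightarrow> nat \<Rightarrow> 'a \<Rightarrow> 'a set" where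
  "skel_ball K r v = {u \<in> sc_vertices K. skel_dist K v u \<le> r}"

definition skel_sphere :: "'a set set \<Rightarrow> nat \<Rightarrow> 'a \<Rightarrow> 'a set" where
  "skel_sphere K r v = {u \<in> sc_vertices K. skel_dist K v u = r}"

definition weakly_systolic :: "'a set set \<Rightarrow> bool" where
  "weakly_systolic K \<longleftrightarrow>
     abstract_simplicial_complex K \<and> sc_vertices K \<noteq> {} \<and> is_flag K \<and> skel_connected K \<and>
     (\<forall>v\<in>sc_vertices K. \<forall>i. \<forall>\<sigma>\<in>K. \<sigma> \<noteq> {} \<and> \<sigma> \<subseteq> skel_sphere K (i + 1) v \<longrightarrow>
        (let \<tau> = {w \<in> skel_ball K i v. \<forall>u\<in>\<sigma>. (w, u) \<in> skel_edges K}
         in \<tau> \<noteq> {} \<and> \<tau> \<in> K))"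

definition sc_locally_finite :: "'a set set \<Rightarrow> bool" where
  "sc_locally_finite K \<longleftrightarrow> (\<forall>v\<in>sc_vertices K. finite {\<sigma>\<in>K. v \<in> \<sigma>})"

definition simplicial_automorphism :: "'a set set \<Rightarrow> ('a \<Rightarrow> 'a) \<Rightarrow> bool" where
  "simplicial_automorphism K f \<longleftrightarrow>
     bij_betw f (sc_vertices K) (sc_vertices K) \<and>
     (\<forall>\<sigma>. \<sigma> \<subseteq> sc_vertices K \<longrightarrow> (f ` \<sigma> \<in> K \<longleftrightarrow> \<sigma> \<in> K))"

definition acts_by_simplicial_automorphisms ::
    "('g, 'b) monoid_scheme \<Rightarrow> 'a set set \<Rightarrow> ('g \<Rightarrow> 'a \<Rightarrow> 'a) \<Rightarrow> bool" where
  "acts_by_simplicial_automorphisms G K \<phi> \<longleftrightarrow>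
     group_action G (sc_vertices K) \<phi> \<and>
     (\<forall>g\<in>carrier G. simplicial_automorphism K (\<phi> g))"

end

theory Submission
  imports Defs
begin

text \<open>
  Balls of a weakly systolic complex are convex, so the intersection of the balls of a large
  radius around the points of an orbit is a finite invariant convex set, which inherits the
  projection property defining weak systolicity. In a finite graph with this property the last
  vertex of a lexicographic breadth-first search is dominated by its father: some neighbour is
  adjacent to all its other neighbours. The property also passes to retracts. Retracting onto
  the vertices with inclusion-maximal closed neighbourhoods is equivariant, so in a minimal
  invariant set domination only occurs between twins. A transversal of the twin classes is again
  a retract, now without dominated vertices, hence a single point; so all vertices are twins
  and the minimal set is a clique.
\<close>

section \<open>Metrics with the projection property\<close>

text \<open>Collects what the argument uses of a 1-skeleton, for a bare set, so that subsets can
  inherit it with the same \<open>d\<close>. \<open>proj_clique\<close> speaks of one vertex only,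
  because the projection of a larger simplex is contained in the projection of each of its
  vertices.\<close>

locale projection_metric =
  fixes S :: "'a set" and d :: "'a \<Rightarrow> 'a \<Rightarrow> nat"
  assumes dist_0: "\<lbrakk>x \<in> S; y \<in> S\<rbrakk> \<Longrightarrow> d x y = 0 \<longleftrightarrow> x = y"
    and dist_sym: "\<lbrakk>x \<in> S; y \<in> S\<rbrakk> \<Longrightarrow> d x y = d y x"
    and dist_tri: "\<lbrakk>x \<in> S; y \<in> S; z \<in> S\<rbrakk> \<Longrightarrow> d x z \<le> d x y + d y z"
    and proj_nonempty: "\<lbrakk>v \<in> S; A \<subseteq> S; A \<noteq> {}; \<forall>x\<in>A. d v x = Suc i; \<forall>x\<in>A. \<forall>y\<in>A. d x y \<le> 1\<rbrakk>
      \<Longrightarrow> \<exists>w\<in>S. d v w = i \<and> (\<forall>x\<in>A. d w x = 1)"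
    and proj_clique: "\<lbrakk>v \<in> S; x \<in> S; y \<in> S; z \<in> S; d v x = Suc i; d v y = i; d v z = i;
      d y x = 1; d z x = 1\<rbrakk> \<Longrightarrow> d y z \<le> 1"
begin

lemma dist_self [simp]: "x \<in> S \<Longrightarrow> d x x = 0"
  by (simp add: dist_0)

lemma proj_vertex:
  assumes "v \<in> S" "x \<in> S" "d v x = Suc i"
  obtains w where "w \<in> S" "d v w = i" "d w x = 1"
  using proj_nonempty[of v "{x}" i] assms by auto

lemma proj_edge:
  assumes "v \<in> S" "x \<in> S" "y \<in> S" "d v x = Suc i" "d v y = Suc i" "d x y = 1"
  obtains w where "w \<in> S" "d v w = i" "d w x = 1" "d w y = 1"
  using proj_nonempty[of v "{x, y}" i] dist_sym[of x y] assms by auto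

lemma proj_triangle:
  assumes "v \<in> S" "x \<in> S" "y \<in> S" "z \<in> S" "d v x = Suc i" "d v y = Suc i" "d v z = Suc i"
    "d x y = 1" "d x z = 1" "d y z = 1"
  obtains w where "w \<in> S" "d v w = i" "d w x = 1" "d w y = 1" "d w z = 1"
  using proj_nonempty[of v "{x, y, z}" i] dist_sym[of x y] dist_sym[of x z] dist_sym[of y z] assms
  by auto

lemma dist_2I:
  assumes "x \<in> S" "y \<in> S" "z \<in> S" "d x y = 1" "d y z = 1" "x \<noteq> z" "d x z \<noteq> 1"
  shows "d x z = 2"
  using dist_tri[of x y z] dist_0[of x z] assms by linarith

text \<open>Seen from \<open>a\<close>, the vertex \<open>c\<close> is at distance 2, and
  \<open>b\<close> and \<open>e\<close> both lie in its projection.\<close>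

lemma no_induced_square:
  assumes "a \<in> S" "b \<in> S" "c \<in> S" "e \<in> S"
    and "d a b = 1" "d b c = 1" "d c e = 1" "d e a = 1" "a \<noteq> c" "d a c \<noteq> 1"
  shows "d b e \<le> 1"
proof -
  have "d a c = Suc 1" using dist_2I[of a b c] assms by simp
  moreover have "d a e = 1" "d e c = 1" using assms dist_sym by metis+
  ultimately show ?thesis using proj_clique[of a c b e 1] assms by simp
qed

subsection \<open>Convexity of balls\<close>

text \<open>Induction along a geodesic from \<open>v\<close> to \<open>w\<close>, looking at the
  predecessor \<open>u\<close> of \<open>w\<close>. The radius has to vary, since \<open>u\<close>
  may be farther from \<open>c\<close> than \<open>w\<close> is.\<close>

lemma ball_exit:
  assumes "c \<in> S" "v \<in> S" "w \<in> S" "d c v \<le> r" "d c w = Suc r" "d v w = i"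
  shows "\<exists>p\<in>S. d c p = r \<and> d p w = 1 \<and> d v p < i"
  using assms
proof (induction i arbitrary: r w)
  case 0
  then show ?case by (simp add: dist_0)
next
  case (Suc i)
  obtain u where u: "u \<in> S" "d v u = i" "d u w = 1"
    using proj_vertex[of v w i] Suc.prems by auto
  have "d c u \<le> Suc r"
  proof (rule ccontr)
    assume "\<not> d c u \<le> Suc r"
    moreover have "d c u \<le> d c w + d w u" "d w u = 1"
      using dist_tri[of c w u] dist_sym[of w u] u Suc.prems by auto
    ultimately have cu: "d c u = Suc (Suc r)" using Suc.prems by linarith
    \<comment> \<open>Both \<open>p\<close> and \<open>w\<close> lie in the projection of
      \<open>u\<close> towards \<open>c\<close>, so they are adjacent or equal, and the way from
      \<open>v\<close> to \<open>w\<close> through \<open>p\<close> is too short.\<close>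
    obtain p where p: "p \<in> S" "d c p = Suc r" "d p u = 1" "d v p < i"
      using Suc.IH[of u "Suc r"] Suc.prems cu u by auto
    have "d p w \<le> 1"
      using proj_clique[of c u p w "Suc r"] p u cu Suc.prems \<open>d w u = 1\<close> by simp
    then show False using dist_tri[of v p w] p Suc.prems by linarith
  qed
  moreover have "d c w \<le> d c u + 1" using dist_tri[of c u w] u Suc.prems by simp
  ultimately consider "d c u = r" | "d c u = Suc r" using Suc.prems by linarith
  then show ?case
  proof cases
    case 1
    then show ?thesis using u by auto
  next
    case 2
    obtain p where p: "p \<in> S" "d c p = r" "d p u = 1" "d v p < i"
      using Suc.IH[of u r] Suc.prems 2 u by auto
    \<comment> \<open>Projecting the edge from \<open>u\<close> to \<open>w\<close> gives
      \<open>q\<close>. It is adjacent or equal to \<open>p\<close>, as both lie in the projection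
      of \<open>u\<close>.\<close>
    obtain q where q: "q \<in> S" "d c q = r" "d q u = 1" "d q w = 1"
      using proj_edge[of c u w r] Suc.prems 2 u by auto
    have "d p q \<le> 1" using proj_clique[of c u p q r] p q u 2 Suc.prems by simp
    then have "d v q < Suc i" using dist_tri[of v p q] p q Suc.prems by linarith
    then show ?thesis using q by auto
  qed
qed

text \<open>If the geodesic predecessor \<open>w\<close> of \<open>u\<close> left the ball,
  \<open>ball_exit\<close> would give a \<open>p\<close> nearer to \<open>v\<close> that lies with
  \<open>u\<close> in the projection of \<open>w\<close> towards \<open>c\<close>; passing through
  \<open>p\<close> would shorten the way from \<open>v\<close> to \<open>u\<close>.\<close>

lemma ball_convex:
  assumes "c \<in> S" "v \<in> S" "w \<in> S" "u \<in> S" "d c v \<le> r" "d c u \<le> r"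
    and "d v w = i" "d w u = 1" "d v u = Suc i"
  shows "d c w \<le> r"
proof (rule ccontr)
  assume "\<not> d c w \<le> r"
  moreover have uw: "d u w = 1" using dist_sym assms by metis
  moreover have "d c w \<le> d c u + 1" using dist_tri[of c u w] uw assms by simp
  ultimately have w: "d c w = Suc r" and u: "d c u = r" using assms by linarith+
  obtain p where p: "p \<in> S" "d c p = r" "d p w = 1" "d v p < i"
    using ball_exit[of c v w r i] assms w by auto
  have "d p u \<le> 1" using proj_clique[of c w p u r] p w u uw assms by simp
  then show False using dist_tri[of v p u] p assms by linarith
qed

section \<open>Inheritance by convex subsets and retracts\<close>

text \<open>The vertex \<open>w\<close> that \<open>S\<close> provides in
  \<open>proj_nonempty\<close> is a geodesic predecessor of every point of \<open>A\<close>, so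
  closure under such predecessors puts it into \<open>T\<close>.\<close>

lemma projection_metric_convex:
  assumes "T \<subseteq> S"
    and conv: "\<And>v w u. \<lbrakk>v \<in> T; w \<in> S; u \<in> T; d w u = 1; d v u = Suc (d v w)\<rbrakk> \<Longrightarrow> w \<in> T"
  shows "projection_metric T d"
proof
  fix v A i
  assume A: "v \<in> T" "A \<subseteq> T" "A \<noteq> {}" "\<forall>x\<in>A. d v x = Suc i" "\<forall>x\<in>A. \<forall>y\<in>A. d x y \<le> 1"
  obtain w where w: "w \<in> S" "d v w = i" "\<forall>x\<in>A. d w x = 1"
    using proj_nonempty[of v A i] A subset_trans[OF A(2) assms(1)] subsetD[OF assms(1) A(1)] by blast
  obtain u where "u \<in> A" using A by blast
  then have "w \<in> T" using conv[of v w u] A w by auto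
  then show "\<exists>w\<in>T. d v w = i \<and> (\<forall>x\<in>A. d w x = 1)" using w by auto
next
  fix x y z
  assume "x \<in> T" "y \<in> T" "z \<in> T"
  then show "d x z \<le> d x y + d y z" using dist_tri assms(1) by blast
next
  fix v x y z i
  assume "v \<in> T" "x \<in> T" "y \<in> T" "z \<in> T" "d v x = Suc i" "d v y = i" "d v z = i"
    "d y x = 1" "d z x = 1"
  then show "d y z \<le> 1" using proj_clique[of v x y z i] assms(1) by blast
qed (use assms(1) dist_0 dist_sym in \<open>simp_all add: subset_iff\<close>)

lemma nonexpansive:
  assumes f: "\<And>x. x \<in> S \<Longrightarrow> f x \<in> S"
    and adj: "\<And>x y. \<lbrakk>x \<in> S; y \<in> S; d x y \<le> 1\<rbrakk> \<Longrightarrow> d (f x) (f y) \<le> 1"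
    and "x \<in> S" "y \<in> S"
  shows "d (f x) (f y) \<le> d x y"
  using assms(4)
proof (induction "d x y" arbitrary: y)
  case 0
  then show ?case using dist_0 assms(3) f by auto
next
  case (Suc i)
  obtain w where w: "w \<in> S" "d x w = i" "d w y = 1"
    using proj_vertex[of x y i] Suc assms(3) by auto
  have "d (f x) (f w) \<le> i" "d (f w) (f y) \<le> 1"
    using Suc(1)[of w] w adj[of w y] Suc.prems by auto
  then show ?case using dist_tri[of "f x" "f w" "f y"] f w Suc assms(3) by fastforce
qed

text \<open>Project in \<open>S\<close> and apply \<open>f\<close> to the result. As
  \<open>f\<close> fixes \<open>v\<close> and \<open>A\<close> and does not increase distances, the
  image is within \<open>i\<close> of \<open>v\<close> and within 1 of \<open>A\<close>; the
  triangle inequality turns both bounds into equalities.\<close>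

lemma projection_metric_retract:
  assumes f: "\<And>x. x \<in> S \<Longrightarrow> f x \<in> T" and "T \<subseteq> S" and id: "\<And>x. x \<in> T \<Longrightarrow> f x = x"
    and adj: "\<And>x y. \<lbrakk>x \<in> S; y \<in> S; d x y \<le> 1\<rbrakk> \<Longrightarrow> d (f x) (f y) \<le> 1"
  shows "projection_metric T d"
proof
  have ne: "d (f x) (f y) \<le> d x y" if "x \<in> S" "y \<in> S" for x y
    using nonexpansive[of f x y] that assms by blast
  fix v A i
  assume A: "v \<in> T" "A \<subseteq> T" "A \<noteq> {}" "\<forall>x\<in>A. d v x = Suc i" "\<forall>x\<in>A. \<forall>y\<in>A. d x y \<le> 1"
  obtain w where w: "w \<in> S" "d v w = i" "\<forall>x\<in>A. d w x = 1"
    using proj_nonempty[of v A i] A subset_trans[OF A(2) assms(2)] subsetD[OF assms(2) A(1)] by blast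
  have vw: "d v (f w) \<le> i" using ne[of v w] id[of v] A w assms(2) by auto
  have wx: "d (f w) x \<le> 1" if "x \<in> A" for x
    using ne[of w x] id[of x] that A w assms(2) by fastforce
  have "d v (f w) = i \<and> d (f w) x = 1" if x: "x \<in> A" for x
  proof -
    have "d v x \<le> d v (f w) + d (f w) x"
      using dist_tri[of v "f w" x] x A f[of w] w assms(2) by blast
    then show ?thesis using vw wx[OF x] A x by force
  qed
  then show "\<exists>w\<in>T. d v w = i \<and> (\<forall>x\<in>A. d w x = 1)" using f[of w] w A(3) by blast
next
  fix x y z
  assume "x \<in> T" "y \<in> T" "z \<in> T"
  then show "d x z \<le> d x y + d y z" using dist_tri assms(2) by blast
next
  fix v x y z i
  assume "v \<in> T" "x \<in> T" "y \<in> T" "z \<in> T" "d v x = Suc i" "d v y = i" "d v z = i"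
    "d y x = 1" "d z x = 1"
  then show "d y z \<le> 1" using proj_clique[of v x y z i] assms(2) by blast
qed (use assms(2) dist_0 dist_sym in \<open>simp_all add: subset_iff\<close>)

end

subsection \<open>Lexicographic breadth-first search\<close>

text \<open>The adjacencies of \<open>v\<close> to the listed vertices are read as binary digits,
  the earliest being the most significant, so that lexicographic comparison of labels becomes
  comparison of numbers.\<close>

fun label_value :: "('a \<Rightarrow> 'a \<Rightarrow> bool) \<Rightarrow> 'a list \<Rightarrow> 'a \<Rightarrow> nat" where
  "label_value E [] v = 0"
| "label_value E (p # ps) v = (if E p v then 2 ^ length ps else 0) + label_value E ps v"

lemma label_value_less: "label_value E ps v < 2 ^ length ps"
  by (induction ps) auto

text \<open>At the first digit where the two labels differ, the larger one has the 1; this digit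
  cannot be \<open>i\<close>, hence precedes it.\<close>

lemma label_value_difference:
  assumes "label_value E ps v \<le> label_value E ps w" "i < length ps" "E (ps ! i) v" "\<not> E (ps ! i) w"
  shows "\<exists>j<i. E (ps ! j) w \<and> \<not> E (ps ! j) v"
  using assms
proof (induction ps arbitrary: i)
  case (Cons p ps)
  show ?case
  proof (cases "E p w \<and> \<not> E p v")
    case True
    then have "i \<noteq> 0" using Cons.prems by (cases i) auto
    then show ?thesis using True by (intro exI[of _ 0]) auto
  next
    case False
    show ?thesis
    proof (cases i)
      case 0
      then have "2 ^ length ps \<le> label_value E ps w" using Cons.prems by simp
      then show ?thesis using label_value_less[of E ps w] by simp
    next
      case (Suc k)
      have "label_value E ps v \<le> label_value E ps w"
        using Cons.prems(1) False label_value_less[of E ps w] by (auto split: if_splits)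
      then obtain j where "j < k" "E (ps ! j) w" "\<not> E (ps ! j) v"
        using Cons.IH[of k] Cons.prems Suc by auto
      then show ?thesis using Suc by (intro exI[of _ "Suc j"]) auto
    qed
  qed
qed simp

text \<open>Lexicographic maximality of each chosen vertex among those not yet visited, written out
  without labels. Partial lists are allowed so that an order can be built one vertex at a
  time.\<close>

definition lexbfs_list :: "'a set \<Rightarrow> ('a \<Rightarrow> 'a \<Rightarrow> bool) \<Rightarrow> 'a list \<Rightarrow> bool" where
  "lexbfs_list S E ps \<longleftrightarrow> distinct ps \<and> set ps \<subseteq> S \<and>
     (\<forall>j<length ps. \<forall>i<j. \<forall>z\<in>S - set (take j ps). E (ps ! i) z \<and> \<not> E (ps ! i) (ps ! j) \<longrightarrow>
        (\<exists>k<i. E (ps ! k) (ps ! j) \<and> \<not> E (ps ! k) z))"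

text \<open>The vertex to append is one of maximal label among the remaining ones.\<close>

lemma lexbfs_list_extend:
  assumes "finite S" "lexbfs_list S E ps" "set ps \<noteq> S"
  obtains w where "lexbfs_list S E (ps @ [w])"
proof -
  define R where "R = S - set ps"
  have R: "finite R" "R \<noteq> {}" using assms by (auto simp: R_def lexbfs_list_def)
  have "Max (label_value E ps ` R) \<in> label_value E ps ` R" using R by (intro Max_in) auto
  then obtain w where w: "w \<in> R" "Max (label_value E ps ` R) = label_value E ps w" by blast
  have w_max: "label_value E ps z \<le> label_value E ps w" if "z \<in> R" for z
    unfolding w(2)[symmetric] using R(1) that by (intro Max_ge) auto
  have "lexbfs_list S E (ps @ [w])"
    unfolding lexbfs_list_def
  proof (intro conjI allI impI ballI)
    show "distinct (ps @ [w])" "set (ps @ [w]) \<subseteq> S"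
      using w assms(2) by (auto simp: R_def lexbfs_list_def)
    fix j i z
    assume j: "j < length (ps @ [w])" and i: "i < j" and z: "z \<in> S - set (take j (ps @ [w]))"
      and E: "E ((ps @ [w]) ! i) z \<and> \<not> E ((ps @ [w]) ! i) ((ps @ [w]) ! j)"
    show "\<exists>k<i. E ((ps @ [w]) ! k) ((ps @ [w]) ! j) \<and> \<not> E ((ps @ [w]) ! k) z"
    proof (cases "j = length ps")
      case True
      have nth: "(ps @ [w]) ! k = ps ! k" if "k < j" for k
        using that True by (simp add: nth_append)
      have "z \<in> R" using z True by (simp add: R_def)
      moreover have "E (ps ! i) z" "\<not> E (ps ! i) w" using E True nth[OF i] by simp_all
      ultimately obtain k where k: "k < i" "E (ps ! k) w" "\<not> E (ps ! k) z"
        using label_value_difference[of E ps z w i] w_max i True by blast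
      then show ?thesis using True i nth[of k] by (intro exI[of _ k]) simp
    next
      case False
      then have "j < length ps" using j by simp
      have nth: "(ps @ [w]) ! k = ps ! k" if "k \<le> j" for k
        using that \<open>j < length ps\<close> by (simp add: nth_append)
      have "\<exists>k<i. E (ps ! k) (ps ! j) \<and> \<not> E (ps ! k) z"
        using assms(2) i z E \<open>j < length ps\<close> nth[of i] nth[of j] unfolding lexbfs_list_def by simp
      then obtain k where "k < i" "E (ps ! k) (ps ! j)" "\<not> E (ps ! k) z" by blast
      then show ?thesis using nth[of k] nth[of j] i by (intro exI[of _ k]) simp
    qed
  qed
  then show ?thesis using that by blast
qed

lemma lexbfs_list_exists:
  assumes "finite S" "r \<in> S"
  obtains ps where "lexbfs_list S E (r # ps)" "set (r # ps) = S"
proof -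
  have "\<exists>qs. lexbfs_list S E (r # ps @ qs) \<and> set (r # ps @ qs) = S"
    if "lexbfs_list S E (r # ps)" for ps
    using that
  proof (induction "card S - length (r # ps)" arbitrary: ps rule: less_induct)
    case less
    show ?case
    proof (cases "set (r # ps) = S")
      case True
      then show ?thesis using less.prems by (intro exI[of _ "[]"]) auto
    next
      case False
      then have "set (r # ps) \<subset> S" using less.prems by (auto simp: lexbfs_list_def)
      then have "card (set (r # ps)) < card S" using assms(1) psubset_card_mono by blast
      then have len: "length (r # ps) < card S"
        using less.prems by (metis distinct_card lexbfs_list_def)
      obtain w where w: "lexbfs_list S E ((r # ps) @ [w])"
        using lexbfs_list_extend[OF assms(1) less.prems False] by blast
      have "\<exists>qs. lexbfs_list S E (r # (ps @ [w]) @ qs) \<and> set (r # (ps @ [w]) @ qs) = S"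
        by (rule less.hyps) (use w len in auto)
      then show ?thesis by (metis append.assoc)
    qed
  qed
  moreover have "lexbfs_list S E [r]" using assms by (auto simp: lexbfs_list_def)
  ultimately show ?thesis using that by fastforce
qed

text \<open>Positions in a complete list give the numbering. The last property is the usual
  four-point characterisation of lexicographic breadth-first orders.\<close>

lemma lexbfs_order_exists:
  fixes S :: "'a set" and E :: "'a \<Rightarrow> 'a \<Rightarrow> bool"
  assumes "finite S" "r \<in> S"
  obtains pos :: "'a \<Rightarrow> nat" where "inj_on pos S" "\<And>x. \<lbrakk>x \<in> S; x \<noteq> r\<rbrakk> \<Longrightarrow> pos r < pos x"
    "\<And>a b z. \<lbrakk>a \<in> S; b \<in> S; z \<in> S; pos a < pos b; pos b < pos z; E a z; \<not> E a b\<rbrakk>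
       \<Longrightarrow> \<exists>c\<in>S. pos c < pos a \<and> E c b \<and> \<not> E c z"
proof -
  obtain ps where "lexbfs_list S E (r # ps)" "set (r # ps) = S"
    using lexbfs_list_exists assms by metis
  then obtain ps where ps: "lexbfs_list S E ps" "set ps = S" "ps ! 0 = r" "ps \<noteq> []"
    by (metis list.distinct(1) nth_Cons_0)
  have dist: "distinct ps" using ps by (auto simp: lexbfs_list_def)
  have "\<exists>i. i < length ps \<and> ps ! i = x" if "x \<in> S" for x
    using that ps(2) by (metis in_set_conv_nth)
  then obtain pos where pos: "\<And>x. x \<in> S \<Longrightarrow> pos x < length ps \<and> ps ! pos x = x"
    by metis
  have pos_nth: "pos (ps ! i) = i" if "i < length ps" for i
    using pos[of "ps ! i"] that ps(2) dist nth_eq_iff_index_eq nth_mem by metis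
  show ?thesis
  proof
    show "inj_on pos S" using pos by (metis inj_onI)
    fix x assume "x \<in> S" "x \<noteq> r"
    then show "pos r < pos x" using pos_nth[of 0] ps pos[of x] by (metis gr0I length_greater_0_conv)
  next
    fix a b z
    assume h: "a \<in> S" "b \<in> S" "z \<in> S" "pos a < pos b" "pos b < pos z" "E a z" "\<not> E a b"
    have "z \<notin> set (take (pos b) ps)"
    proof
      assume "z \<in> set (take (pos b) ps)"
      then obtain i where "i < pos b" "i < length ps" "ps ! i = z"
        by (auto simp: in_set_conv_nth)
      then show False using pos_nth h by auto
    qed
    then have "\<exists>k<pos a. E (ps ! k) (ps ! pos b) \<and> \<not> E (ps ! k) z"
      using ps(1) h(3-7) pos(1)[OF h(1)] pos(1)[OF h(2)] unfolding lexbfs_list_def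
      by (metis Diff_iff)
    then obtain k where k: "k < pos a" "E (ps ! k) b" "\<not> E (ps ! k) z"
      using pos[of b] h by auto
    moreover have "k < length ps" using k pos[of a] h by simp
    ultimately show "\<exists>c\<in>S. pos c < pos a \<and> E c b \<and> \<not> E c z"
      using pos_nth[of k] ps(2) by (intro bexI[of _ "ps ! k"]) auto
  qed
qed


section \<open>Levels and fathers in a lexicographic breadth-first order\<close>

locale lexbfs_order = projection_metric +
  fixes r :: 'a and pos :: "'a \<Rightarrow> nat"
  assumes root: "r \<in> S" "\<And>x. \<lbrakk>x \<in> S; x \<noteq> r\<rbrakk> \<Longrightarrow> pos r < pos x"
    and pos_inj: "inj_on pos S"
    and lexbfs: "\<lbrakk>a \<in> S; b \<in> S; z \<in> S; pos a < pos b; pos b < pos z; d a z = 1; d a b \<noteq> 1\<rbrakk>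
       \<Longrightarrow> \<exists>c\<in>S. pos c < pos a \<and> d c b = 1 \<and> d c z \<noteq> 1"
begin

lemma pos_linear: "\<lbrakk>x \<in> S; y \<in> S; x \<noteq> y\<rbrakk> \<Longrightarrow> pos x < pos y \<or> pos y < pos x"
  using pos_inj by (meson inj_onD linorder_neqE_nat)

text \<open>Let \<open>b\<close> be earlier than \<open>z\<close> but on a higher level. A neighbour
  \<open>a\<close> of \<open>z\<close> one level down precedes \<open>b\<close> by induction and is
  not adjacent to it, so \<open>lexbfs\<close> gives a neighbour \<open>c\<close> of
  \<open>b\<close> before \<open>a\<close>. By induction \<open>c\<close> is no higher than
  \<open>a\<close>, so \<open>b\<close> is no higher than \<open>z\<close>.\<close>

lemma level_mono: "\<lbrakk>b \<in> S; z \<in> S; pos b < pos z\<rbrakk> \<Longrightarrow> d r b \<le> d r z"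
proof (induction "d r z" arbitrary: b z)
  case 0
  then have "z = r" using dist_0 root(1) by metis
  then show ?case using root(2)[of b] 0 by fastforce
next
  case (Suc m)
  show ?case
  proof (rule ccontr)
    assume far: "\<not> d r b \<le> d r z"
    obtain a where a: "a \<in> S" "d r a = m" "d a z = 1"
      using proj_vertex[of r z m] Suc root(1) by metis
    have ab: "pos a < pos b"
    proof (rule ccontr)
      assume "\<not> pos a < pos b"
      then have "a = b \<or> pos b < pos a" using pos_linear a Suc.prems by blast
      then show False using Suc(1)[of a b] a Suc far by auto
    qed
    have "d a b \<noteq> 1" using dist_tri[of r a b] a Suc far root(1) by auto
    then obtain c where c: "c \<in> S" "pos c < pos a" "d c b = 1"
      using lexbfs[of a b z] a ab Suc.prems by auto
    have "d r c \<le> m" using Suc(1)[of a c] a c by simp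
    then show False using dist_tri[of r c b] c Suc far root(1) by auto
  qed
qed

text \<open>The earliest neighbour one level closer to the root; for the root itself there is no
  candidate and the value is arbitrary.\<close>

definition father :: "'a \<Rightarrow> 'a" where
  "father y = arg_min pos (\<lambda>w. w \<in> S \<and> d w y = 1 \<and> d r y = Suc (d r w))"

lemma father:
  assumes "y \<in> S" "d r y = Suc n"
  shows "father y \<in> S" "d (father y) y = 1" "d r (father y) = n"
    and "\<And>w. \<lbrakk>w \<in> S; d w y = 1; d r w = n\<rbrakk> \<Longrightarrow> pos (father y) \<le> pos w"
proof -
  let ?P = "\<lambda>w. w \<in> S \<and> d w y = 1 \<and> d r y = Suc (d r w)"
  obtain w where "?P w" using proj_vertex[of r y n] assms root(1) by metis
  then have "?P (father y)" unfolding father_def by (rule arg_min_natI)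
  then show "father y \<in> S" "d (father y) y = 1" "d r (father y) = n" using assms by auto
  show "pos (father y) \<le> pos w" if "w \<in> S" "d w y = 1" "d r w = n" for w
    unfolding father_def by (rule arg_min_nat_le) (use that assms in simp)
qed

text \<open>If the father of \<open>y\<close> came first, it would not be adjacent to
  \<open>x\<close>, and \<open>lexbfs\<close> would give an even earlier neighbour of
  \<open>x\<close>, necessarily on level \<open>n\<close>, against the choice of the father of
  \<open>x\<close>.\<close>

lemma father_mono:
  assumes "x \<in> S" "y \<in> S" "pos x < pos y" "d r x = Suc n" "d r y = Suc n"
  shows "pos (father x) \<le> pos (father y)"
proof (rule ccontr)
  assume less: "\<not> pos (father x) \<le> pos (father y)"
  note fx = father[OF assms(1,4)] and fy = father[OF assms(2,5)]
  have "pos (father y) < pos x"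
    using level_mono[of x "father y"] pos_linear[of x "father y"] fy assms by force
  moreover have "d (father y) x \<noteq> 1" using fx(4)[of "father y"] fy less by auto
  ultimately obtain c where c: "c \<in> S" "pos c < pos (father y)" "d c x = 1"
    using lexbfs[of "father y" x y] fy assms by auto
  have "d r c \<le> n" using level_mono[of c "father y"] c fy by simp
  moreover have "Suc n \<le> d r c + 1" using dist_tri[of r c x] c assms root(1) by simp
  ultimately have "pos (father x) \<le> pos c" using fx(4)[of c] c by simp
  then show False using c less by simp
qed

text \<open>
  The fathers \<open>a\<close> and \<open>b\<close> of \<open>x\<close> and \<open>y\<close> have to be adjacent; otherwise they have a common
  neighbour \<open>z\<close> below both \<open>x\<close> and \<open>y\<close>. As \<open>b\<close> precedes \<open>z\<close> there is a first \<open>c\<close> adjacent to \<open>b\<close> but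
  not to \<open>z\<close>, and as \<open>a\<close> precedes \<open>b\<close> there is a first \<open>u\<close>, earlier than \<open>c\<close>, adjacent to \<open>a\<close> but not
  to \<open>b\<close>. Projecting \<open>y\<close> or the triangle \<open>x\<close>, \<open>y\<close>, \<open>z\<close> towards \<open>u\<close> contradicts the choice of \<open>u\<close>.
\<close>

lemma father_dominates:
  assumes "x \<in> S" "y \<in> S" "d x y = 1" "pos x < pos y" "d r x = Suc n" "d r y = Suc n"
  shows "d x (father y) = 1"
  using assms
proof (induction n arbitrary: x y)
  case 0
  have "father y = r" using father[of y 0] 0 dist_0 root(1) by metis
  then show ?case using 0 dist_sym[of x r] root(1) by simp
next
  case (Suc n)
  define a b where "a = father x" and "b = father y"
  note xy = Suc.prems
  have yx: "d y x = 1" using dist_sym xy by metis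
  note a = father[OF xy(1,5), folded a_def] and b = father[OF xy(2,6), folded b_def]
  have ab_le: "pos a \<le> pos b" using father_mono[of x y] xy by (simp add: a_def b_def)
  show ?case
  proof (rule ccontr)
    assume "d x (father y) \<noteq> 1"
    then have xb: "d x b \<noteq> 1" "d b x \<noteq> 1" using dist_sym xy b unfolding b_def by metis+
    have "a \<noteq> b" using a xb by auto
    then have ab: "pos a < pos b" using pos_linear a b ab_le by fastforce
    have ay: "d a y \<noteq> 1" using b(4)[of a] a ab by auto
    have yb: "d y b = 1" using dist_sym b xy by metis
    \<comment> \<open>Adjacent fathers would close the 4-cycle \<open>a\<close>, \<open>x\<close>,
      \<open>y\<close>, \<open>b\<close>. Its diagonal from \<open>a\<close> to \<open>y\<close> is
      missing, so the other one, from \<open>x\<close> to \<open>b\<close>, would be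
      present.\<close>
    have nab: "d a b \<noteq> 1"
    proof
      assume ab1: "d a b = 1"
      have "a \<noteq> y" using xy a by auto
      then have "d x b \<le> 1"
        using no_induced_square[of a x y b] xy a b ab1 yb ay dist_sym[of b a] by auto
      moreover have "x \<noteq> b" using xy b by auto
      ultimately show False using xb dist_0[of x b] xy b by linarith
    qed
    have no_square: False if "q \<in> S" "t \<in> S" "d q a = 1" "d q b = 1" "d a t = 1" "d b t = 1"
      "d q t \<noteq> 1" "q \<noteq> t" for q t
    proof -
      have "d a q = 1" "d t b = 1" using dist_sym that a b by metis+
      then have "d q t \<le> 1"
        using no_induced_square[of a q b t] that a b nab \<open>a \<noteq> b\<close> dist_sym[of t a] by auto
      then show False using dist_0[of q t] that by linarith
    qed
    \<comment> \<open>Such a \<open>t\<close> lies with \<open>a\<close> in the projection of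
      \<open>x\<close> towards \<open>r\<close>, and with \<open>b\<close> in that of
      \<open>y\<close>. It comes after \<open>b\<close> because it was a candidate for the father of
      \<open>y\<close>.\<close>
    have common: "d a t = 1 \<and> d b t = 1 \<and> pos b < pos t"
      if t: "t \<in> S" "d r t = Suc n" "d t x = 1" "d t y = 1" for t
    proof -
      have "d a t \<le> 1" using proj_clique[of r x a t "Suc n"] a t xy root(1) by auto
      moreover have "d b t \<le> 1" using proj_clique[of r y b t "Suc n"] b t xy root(1) by auto
      moreover have "t \<noteq> a" "t \<noteq> b" using t ay xb by auto
      ultimately show ?thesis
        using dist_0[of a t] dist_0[of b t] a b t b(4)[of t] pos_linear[of b t] by force
    qed
    obtain z where z: "z \<in> S" "d r z = Suc n" "d z x = 1" "d z y = 1"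
      using proj_edge[of r x y "Suc n"] xy root(1) by metis
    have az: "d a z = 1" and bz: "d b z = 1" and pbz: "pos b < pos z" using common z by auto
    define c where "c = arg_min pos (\<lambda>c. c \<in> S \<and> d c b = 1 \<and> d c z \<noteq> 1)"
    obtain c0 where c0: "c0 \<in> S" "pos c0 < pos a" "d c0 b = 1" "d c0 z \<noteq> 1"
      using lexbfs[of a b z] a b z ab pbz az nab by auto
    have c: "c \<in> S" "d c b = 1" "d c z \<noteq> 1"
      using arg_min_natI[of "\<lambda>c. c \<in> S \<and> d c b = 1 \<and> d c z \<noteq> 1" c0 pos] c0
      unfolding c_def by auto
    have c_min: "pos c \<le> pos c'" if "c' \<in> S" "d c' b = 1" "d c' z \<noteq> 1" for c'
      unfolding c_def by (rule arg_min_nat_le) (use that in simp)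
    have ca: "pos c < pos a" using c_min[of c0] c0 by simp
    have "c \<noteq> z" using ca ab pbz by auto
    then have nca: "d c a \<noteq> 1" using no_square[of c z] c z az bz by auto
    define u where "u = arg_min pos (\<lambda>u. u \<in> S \<and> d u a = 1 \<and> d u b \<noteq> 1)"
    obtain u0 where u0: "u0 \<in> S" "pos u0 < pos c" "d u0 a = 1" "d u0 b \<noteq> 1"
      using lexbfs[of c a b] a b c ca ab nca by auto
    have u: "u \<in> S" "d u a = 1" "d u b \<noteq> 1"
      using arg_min_natI[of "\<lambda>u. u \<in> S \<and> d u a = 1 \<and> d u b \<noteq> 1" u0 pos] u0
      unfolding u_def by auto
    have u_min: "pos u \<le> pos u'" if "u' \<in> S" "d u' a = 1" "d u' b \<noteq> 1" for u'
      unfolding u_def by (rule arg_min_nat_le) (use that in simp)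
    have uc: "pos u < pos c" using u_min[of u0] u0 by simp
    \<comment> \<open>Otherwise \<open>lexbfs\<close> for \<open>u\<close>, \<open>b\<close>,
      \<open>z\<close> would yield a competitor of \<open>c\<close> that is earlier than
      \<open>u\<close>, hence than \<open>c\<close>.\<close>
    have uz: "d u z \<noteq> 1"
      using lexbfs[of u b z] u b z uc ca ab pbz c_min by fastforce
    have ru: "d r u \<le> Suc n" using level_mono[of u a] u a uc ca by simp
    \<comment> \<open>A neighbour \<open>u\<close> of \<open>w\<close> would be on level
      \<open>Suc n\<close> and be a candidate for the father of \<open>w\<close> that is earlier
      than the father.\<close>
    have u_up: "d u w \<noteq> 1" if "w \<in> S" "d r w = Suc (Suc n)" "pos a \<le> pos (father w)" for w
      using father(4)[OF that(1,2), of u] dist_tri[of r u w] that ru u uc ca root(1) by fastforce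
    have ux: "d u x \<noteq> 1" and uy: "d u y \<noteq> 1"
      using u_up[of x] u_up[of y] xy ab_le by (auto simp: a_def b_def)
    \<comment> \<open>This puts \<open>u\<close> at distance 2 from \<open>b\<close>. If
      \<open>u\<close> is on level \<open>n\<close>, the father of \<open>z\<close> serves: by
      induction it is adjacent to \<open>a\<close> and \<open>b\<close>, and it shares with
      \<open>u\<close> the projection of \<open>a\<close>. If \<open>u\<close> is on level
      \<open>Suc n\<close>, the father of \<open>a\<close> serves: it is adjacent to
      \<open>u\<close> by induction, and to \<open>b\<close> by minimality of
      \<open>u\<close>.\<close>
    obtain w where w: "w \<in> S" "d u w = 1" "d w b = 1"
    proof -
      have fz: "d (father z) z = 1" "father z \<in> S" "d r (father z) = n" using father[OF z(1,2)] by auto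
      have fza: "d a (father z) = 1" and fzb: "d b (father z) = 1"
        using Suc.IH[of a z] Suc.IH[of b z] a b z az bz ab pbz by auto
      have "Suc n \<le> d r u + 1" using dist_tri[of r u a] u a root(1) by simp
      then consider "d r u = n" | "d r u = Suc n" using ru by linarith
      then show ?thesis
      proof cases
        case 1
        have "d u (father z) \<le> 1"
          using proj_clique[of r a u "father z" n] 1 a u fz fza root(1) dist_sym[of a "father z"]
          by simp
        moreover have "u \<noteq> father z" using fz uz by auto
        ultimately have "d u (father z) = 1" using dist_0[of u "father z"] u fz by linarith
        then show ?thesis using that[of "father z"] fz fzb dist_sym[of b "father z"] b by simp
      next
        case 2
        note fa = father[OF a(1,3)]
        have ufa: "d u (father a) = 1" using Suc.IH[of u a] 2 u a uc ca by simp
        have "pos (father a) < pos u"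
          using level_mono[of u "father a"] pos_linear[of u "father a"] 2 fa u by force
        then have "d (father a) b = 1" using u_min[of "father a"] fa by force
        then show ?thesis using that[of "father a"] fa ufa by simp
      qed
    qed
    have "u \<noteq> b" "u \<noteq> z" using uc ca ab pbz by auto
    then have dub: "d u b = 2" using dist_2I[of u w b] u w b by simp
    have "u \<noteq> x" "u \<noteq> y" using ru xy by auto
    then have dux: "d u x = 2" using dist_2I[of u a x] u a xy ux by simp
    have duz: "d u z = 2" using dist_2I[of u a z] u a z uz az \<open>u \<noteq> z\<close> by simp
    have "d u y \<noteq> 0" using dist_0[of u y] u xy \<open>u \<noteq> y\<close> by simp
    moreover have "d u y \<le> 3" using dist_tri[of u b y] u b xy dub by simp
    ultimately consider "d u y = 2" | "d u y = 3" using uy by linarith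
    then show False
    proof cases
      case 1
      have "d x z = 1" "d y z = 1" using dist_sym xy z by metis+
      then obtain t where t: "t \<in> S" "d u t = 1" "d t x = 1" "d t y = 1" "d t z = 1"
        using proj_triangle[of u x y z 1] u xy z dux duz 1 by (auto simp: numeral_2_eq_2)
      have "d r t \<le> d r u + 1" "d r x \<le> d r t + 1"
        using dist_tri[of r u t] dist_tri[of r t x] t u xy root(1) by auto
      \<comment> \<open>On that level \<open>t\<close> would have both \<open>u\<close> and
        \<open>z\<close> in its projection towards \<open>r\<close>, making them adjacent.\<close>
      moreover have "d r t \<noteq> Suc (Suc n)"
      proof
        assume rt: "d r t = Suc (Suc n)"
        have "d r u = Suc n" using rt ru \<open>d r t \<le> d r u + 1\<close> by simp
        then have "d u z \<le> 1"
          using proj_clique[of r t u z "Suc n"] rt t u z root(1) dist_sym[of t z] by simp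
        then show False using duz by simp
      qed
      ultimately have "d r t = Suc n" using ru xy by linarith
      then have at: "d a t = 1" and bt: "d b t = 1" and pbt: "pos b < pos t"
        using common t by auto
      \<comment> \<open>If \<open>q\<close> is adjacent to \<open>a\<close>, then \<open>q\<close>
        and \<open>t\<close> are non-adjacent common neighbours of \<open>a\<close> and
        \<open>b\<close>; if not, \<open>lexbfs\<close> for \<open>q\<close>, \<open>a\<close>,
        \<open>b\<close> contradicts the minimality of \<open>u\<close>.\<close>
      obtain q where q: "q \<in> S" "pos q < pos u" "d q b = 1" "d q t \<noteq> 1"
        using lexbfs[of u b t] u b t pbt uc ca ab by auto
      show False
      proof (cases "d q a = 1")
        case True
        have "q \<noteq> t" using q uc ca ab pbt by auto
        then show False using no_square[of q t] q t at bt True by auto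
      next
        case False
        then obtain u' where "u' \<in> S" "pos u' < pos q" "d u' a = 1" "d u' b \<noteq> 1"
          using lexbfs[of q a b] q a b uc ca ab by auto
        then show False using u_min[of u'] q by simp
      qed
    next
      case 2
      \<comment> \<open>Here \<open>x\<close> and \<open>b\<close> both lie in the projection of
        \<open>y\<close> towards \<open>u\<close>.\<close>
      have "d x b \<le> 1"
        using proj_clique[of u y x b 2] u xy b dux dub 2 by simp
      moreover have "x \<noteq> b" using xy b by auto
      ultimately show False using xb dist_0[of x b] xy b by linarith
    qed
  qed
qed

text \<open>No level exceeds that of the last vertex. Neighbours one level down share its projection
  with the father, and those on its own level are earlier, so \<open>father_dominates\<close>
  applies.\<close>

lemma last_dominated:
  assumes "y \<in> S" "y \<noteq> r" "\<And>x. x \<in> S \<Longrightarrow> pos x \<le> pos y" "x \<in> S" "d x y \<le> 1"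
  shows "d x (father y) \<le> 1"
proof -
  have "d r y \<noteq> 0" using dist_0 assms root(1) by metis
  then obtain n where n: "d r y = Suc n" by (cases "d r y") auto
  note f = father[OF assms(1) n]
  show ?thesis
  proof (cases "x = y")
    case True
    then show ?thesis using dist_sym f assms by simp
  next
    case False
    then have xy: "d x y = 1" "pos x < pos y"
      using assms dist_0[of x y] pos_linear[of x y] by fastforce+
    have "d r x \<le> Suc n" using level_mono[of x y] xy assms n by simp
    moreover have "Suc n \<le> d r x + 1" using dist_tri[of r x y] xy assms n root(1) by simp
    ultimately consider "d r x = n" | "d r x = Suc n" by linarith
    then show ?thesis
    proof cases
      case 1
      then show ?thesis using proj_clique[of r y x "father y" n] f assms xy n root(1) by simp
    next
      case 2
      then show ?thesis using father_dominates[of x y n] assms xy n by simp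
    qed
  qed
qed

end

text \<open>Search from \<open>r\<close> and take the last vertex and its father; the second point
  \<open>r'\<close> ensures that the last vertex is not the root.\<close>

lemma (in projection_metric) dominated_vertex_exists:
  assumes "finite S" "r \<in> S" "r' \<in> S" "r \<noteq> r'"
  obtains y w where "y \<in> S" "w \<in> S" "w \<noteq> y" "\<And>x. \<lbrakk>x \<in> S; d x y \<le> 1\<rbrakk> \<Longrightarrow> d x w \<le> 1"
proof -
  obtain pos :: "'a \<Rightarrow> nat" where pos: "inj_on pos S" "\<And>x. \<lbrakk>x \<in> S; x \<noteq> r\<rbrakk> \<Longrightarrow> pos r < pos x"
    "\<And>a b z. \<lbrakk>a \<in> S; b \<in> S; z \<in> S; pos a < pos b; pos b < pos z; d a z = 1; d a b \<noteq> 1\<rbrakk>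
       \<Longrightarrow> \<exists>c\<in>S. pos c < pos a \<and> d c b = 1 \<and> d c z \<noteq> 1"
    using lexbfs_order_exists[OF assms(1,2), of "\<lambda>x y. d x y = 1"] by metis
  interpret lexbfs_order S d r pos
    using pos assms(2) by unfold_locales
  have "Max (pos ` S) \<in> pos ` S" using assms by (intro Max_in) auto
  then obtain y where y: "y \<in> S" "pos y = Max (pos ` S)" by force
  have y_max: "pos x \<le> pos y" if "x \<in> S" for x
    unfolding y(2) using assms(1) that by (intro Max_ge) auto
  have "y \<noteq> r" using pos(2)[of r'] y_max[of r'] assms by force
  then have "d r y \<noteq> 0" using dist_0 y assms(2) by metis
  then obtain n where n: "d r y = Suc n" by (cases "d r y") auto
  note f = father[OF y(1) n]
  have "father y \<noteq> y" using f(3) n n_not_Suc_n by metis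
  show ?thesis
  proof (rule that[OF y(1) f(1) \<open>father y \<noteq> y\<close>])
    fix x assume "x \<in> S" "d x y \<le> 1"
    then show "d x (father y) \<le> 1" using last_dominated[OF y(1) \<open>y \<noteq> r\<close> y_max] by blast
  qed
qed


subsection \<open>Invariant cliques\<close>

text \<open>Strong induction on the cardinality: either the set \<open>M\<close> of vertices with
  maximal closed neighbourhood is smaller and inherits all hypotheses, or \<open>M = S\<close> and
  \<open>S\<close> itself is a clique.\<close>

lemma invariant_clique_exists:
  fixes S :: "'a set" and d :: "'a \<Rightarrow> 'a \<Rightarrow> nat" and H :: "('a \<Rightarrow> 'a) set"
  assumes "finite S" "S \<noteq> {}" "projection_metric S d"
    and "\<And>h. h \<in> H \<Longrightarrow> h ` S = S" "\<And>h x y. \<lbrakk>h \<in> H; x \<in> S; y \<in> S\<rbrakk> \<Longrightarrow> d (h x) (h y) = d x y"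
  shows "\<exists>A\<subseteq>S. A \<noteq> {} \<and> (\<forall>x\<in>A. \<forall>y\<in>A. d x y \<le> 1) \<and> (\<forall>h\<in>H. h ` A = A)"
  using assms
proof (induction "card S" arbitrary: S rule: less_induct)
  case less
  interpret projection_metric S d by (fact less.prems(3))
  define N where "N x = {z \<in> S. d x z \<le> 1}" for x
  define M where "M = {x \<in> S. \<forall>y\<in>S. N x \<subseteq> N y \<longrightarrow> N y = N x}"
  have N_sym: "x \<in> N y \<longleftrightarrow> y \<in> N x" if "x \<in> S" "y \<in> S" for x y
    using that dist_sym by (auto simp: N_def)
  \<comment> \<open>Enlarging closed neighbourhoods preserves adjacency: from \<open>y\<close> in
    \<open>N x\<close> follows \<open>y\<close> in \<open>N (f x)\<close>, so \<open>f x\<close> is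
    in \<open>N y\<close> and hence in \<open>N (f y)\<close>.\<close>
  have retract: "projection_metric T d"
    if T: "T \<subseteq> S" and f: "\<And>x. x \<in> S \<Longrightarrow> f x \<in> T \<and> N x \<subseteq> N (f x)" and id: "\<And>x. x \<in> T \<Longrightarrow> f x = x"
    for T f
  proof (rule projection_metric_retract[of f])
    fix x y assume xy: "x \<in> S" "y \<in> S" "d x y \<le> 1"
    then have "y \<in> N (f x)" using f[OF xy(1)] by (auto simp: N_def)
    then have "f x \<in> N (f y)" using N_sym[of y "f x"] f[OF xy(1)] f[OF xy(2)] T xy by blast
    then show "d (f x) (f y) \<le> 1"
      using N_sym[of "f x" "f y"] f[OF xy(1)] f[OF xy(2)] T by (auto simp: N_def)
  qed (use f T id in auto)
  have "\<exists>y\<in>M. N x \<subseteq> N y" if x: "x \<in> S" for x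
  proof -
    obtain Y where Y: "Y \<in> N ` S" "N x \<subseteq> Y" "\<forall>B\<in>N ` S. Y \<subseteq> B \<longrightarrow> Y = B"
      using finite_has_maximal2[of "N ` S" "N x"] less.prems(1) x by auto
    then obtain y where y: "y \<in> S" "Y = N y" by blast
    then have "y \<in> M" using Y(3) unfolding M_def by blast
    then show ?thesis using Y(2) y by blast
  qed
  then obtain m where m: "\<And>x. x \<in> S \<Longrightarrow> m x \<in> M \<and> N x \<subseteq> N (m x)" by metis
  have MS: "M \<subseteq> S" by (auto simp: M_def)
  have inv: "h ` M = M" if h: "h \<in> H" for h
  proof -
    have inj: "inj_on h S" using less.prems(5)[OF h] dist_0 by (metis dist_self inj_onI)
    have Nh: "N (h x) = h ` N x" if "x \<in> S" for x
    proof -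
      have "N (h x) = {z \<in> h ` S. d (h x) z \<le> 1}" using less.prems(4)[OF h] by (simp add: N_def)
      also have "\<dots> = h ` N x" using less.prems(5)[OF h that] by (auto simp: N_def)
      finally show ?thesis .
    qed
    have "h ` M \<subseteq> M"
    proof
      fix z assume "z \<in> h ` M"
      then obtain x where x: "x \<in> M" "z = h x" by blast
      have "N y = N (h x)" if y: "y \<in> S" "N (h x) \<subseteq> N y" for y
      proof -
        obtain y' where y': "y' \<in> S" "y = h y'" using less.prems(4)[OF h] y by blast
        then have "h ` N x \<subseteq> h ` N y'" using Nh y x MS by auto
        then have "N x \<subseteq> N y'"
          using inj_on_image_mem_iff[OF inj, of _ "N y'"] by (auto simp: N_def)
        then show ?thesis using x y' Nh MS by (auto simp: M_def)
      qed
      then show "z \<in> M" using x MS less.prems(4)[OF h] by (auto simp: M_def)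
    qed
    moreover have "finite M" "inj_on h M"
      using MS less.prems(1) inj by (auto intro: finite_subset inj_on_subset)
    ultimately show ?thesis by (simp add: endo_inj_surj)
  qed
  show ?case
  proof (cases "M = S")
    case False
    then have "card M < card S" using MS less.prems(1) by (simp add: psubsetI psubset_card_mono)
    moreover have "finite M" "M \<noteq> {}"
      using MS less.prems m by (auto intro: finite_subset)
    moreover have "projection_metric M d"
      \<comment> \<open>The choice \<open>m\<close> may move a vertex of \<open>M\<close> to a twin;
        the case distinction makes the map fix \<open>M\<close> pointwise.\<close>
      by (rule retract[of _ "\<lambda>x. if x \<in> M then x else m x"]) (use MS m in auto)
    moreover have "d (h x) (h y) = d x y" if "h \<in> H" "x \<in> M" "y \<in> M" for h x y
      using less.prems(5)[of h x y] that MS by blast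
    ultimately have "\<exists>A\<subseteq>M. A \<noteq> {} \<and> (\<forall>x\<in>A. \<forall>y\<in>A. d x y \<le> 1) \<and> (\<forall>h\<in>H. h ` A = A)"
      using inv by (intro less.hyps) auto
    then show ?thesis using MS by (meson order_trans)
  next
    case True
    \<comment> \<open>The choice depends on \<open>N x\<close> alone, so twins get the same
      representative.\<close>
    define t where "t x = (SOME y. y \<in> S \<and> N y = N x)" for x
    have t: "t x \<in> S" "N (t x) = N x" if "x \<in> S" for x
      using someI[of "\<lambda>y. y \<in> S \<and> N y = N x" x] that by (auto simp: t_def)
    have t_eq: "t x = t y" if "N x = N y" for x y
      using that by (simp add: t_def)
    have TS: "t ` S \<subseteq> S" using t by blast
    have tt: "t x = x" if x: "x \<in> t ` S" for x
    proof -
      obtain y where y: "y \<in> S" "x = t y" using x by blast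
      then have "N x = N y" using t(2)[OF y(1)] by simp
      then show ?thesis using t_eq[of x y] y(2) by metis
    qed
    have "t x \<in> t ` S \<and> N x \<subseteq> N (t x)" if "x \<in> S" for x
      using t(2)[OF that] that by simp
    then interpret T: projection_metric "t ` S" d
      using retract[of "t ` S" t] TS tt by metis
    have single: "x = y" if xy: "x \<in> t ` S" "y \<in> t ` S" for x y
    proof (rule ccontr)
      assume "x \<noteq> y"
      obtain a b where ab: "a \<in> t ` S" "b \<in> t ` S" "b \<noteq> a"
        and dom: "\<And>x. \<lbrakk>x \<in> t ` S; d x a \<le> 1\<rbrakk> \<Longrightarrow> d x b \<le> 1"
        using T.dominated_vertex_exists[OF _ xy \<open>x \<noteq> y\<close>] less.prems(1) by (metis finite_imageI)
      have abS: "a \<in> S" "b \<in> S" using ab TS by auto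
      \<comment> \<open>Domination among representatives lifts to \<open>S\<close>, since replacing
        \<open>z\<close> by \<open>t z\<close> does not change its neighbourhood. As all
        neighbourhoods are maximal, \<open>a\<close> and \<open>b\<close> are then twins, hence
        equal.\<close>
      have "N a \<subseteq> N b"
      proof
        fix z assume z: "z \<in> N a"
        then have zS: "z \<in> S" by (simp add: N_def)
        have "a \<in> N (t z)" using N_sym[of a z] z zS abS t(2)[OF zS] by simp
        then have "d (t z) b \<le> 1" using dom[of "t z"] zS by (simp add: N_def)
        then have "b \<in> N z" using t(2)[OF zS] abS by (auto simp: N_def)
        then show "z \<in> N b" using N_sym zS abS by blast
      qed
      then have "N b = N a" using True abS by (auto simp: M_def)
      then show False using tt ab t_eq by metis
    qed
    have "d x y \<le> 1" if "x \<in> S" "y \<in> S" for x y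
    proof -
      have "N x = N y" using single[of "t x" "t y"] t that by (metis imageI)
      then have "y \<in> N x" using that by (simp add: N_def)
      then show ?thesis by (simp add: N_def)
    qed
    then show ?thesis using less.prems by (intro exI[of _ S]) auto
  qed
qed

subsection \<open>Weakly systolic complexes\<close>

context
  fixes K :: "'a set set"
  assumes ws: "weakly_systolic K"
begin

lemma skel_edges_vertices: "(u, v) \<in> skel_edges K \<Longrightarrow> u \<in> sc_vertices K \<and> v \<in> sc_vertices K"
  by (auto simp: skel_edges_def sc_vertices_def)

lemma skel_edges_sym: "(u, v) \<in> skel_edges K \<Longrightarrow> (v, u) \<in> skel_edges K"
  by (auto simp: skel_edges_def insert_commute)

lemma skel_dist_le: "(u, v) \<in> skel_edges K ^^ n \<Longrightarrow> skel_dist K u v \<le> n"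
  unfolding skel_dist_def by (rule Least_le)

lemma skel_dist_path:
  assumes "u \<in> sc_vertices K" "v \<in> sc_vertices K"
  shows "(u, v) \<in> skel_edges K ^^ skel_dist K u v"
proof -
  have "(u, v) \<in> (skel_edges K)\<^sup>*"
    using ws assms by (auto simp: weakly_systolic_def skel_connected_def)
  then obtain n where "(u, v) \<in> skel_edges K ^^ n" by (auto simp: rtrancl_power)
  then show ?thesis unfolding skel_dist_def by (rule LeastI)
qed

lemma skel_dist_1_iff:
  assumes "u \<in> sc_vertices K" "v \<in> sc_vertices K"
  shows "skel_dist K u v = 1 \<longleftrightarrow> (u, v) \<in> skel_edges K"
proof
  assume "skel_dist K u v = 1"
  then show "(u, v) \<in> skel_edges K" using skel_dist_path[OF assms] by simp
next
  assume e: "(u, v) \<in> skel_edges K"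
  then have "skel_dist K u v \<le> 1" by (intro skel_dist_le) simp
  moreover have "skel_dist K u v \<noteq> 0"
  proof
    assume "skel_dist K u v = 0"
    then have "u = v" using skel_dist_path[OF assms] by simp
    then show False using e by (simp add: skel_edges_def)
  qed
  ultimately show "skel_dist K u v = 1" by simp
qed

lemma clique_is_simplex:
  assumes "A \<subseteq> sc_vertices K" "\<And>x y. \<lbrakk>x \<in> A; y \<in> A\<rbrakk> \<Longrightarrow> skel_dist K x y \<le> 1"
  shows "A \<in> K"
proof -
  have "\<exists>\<sigma>\<in>K. x \<in> \<sigma> \<and> y \<in> \<sigma>" if xy: "x \<in> A" "y \<in> A" for x y
  proof (cases "skel_dist K x y = 0")
    case True
    then have "x = y" using skel_dist_path[of x y] xy assms by auto
    then show ?thesis using xy assms(1) by (auto simp: sc_vertices_def)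
  next
    case False
    then have "skel_dist K x y = 1" using assms(2)[OF xy] by simp
    then have "(x, y) \<in> skel_edges K" using skel_dist_1_iff xy assms(1) by blast
    then show ?thesis by (auto simp: skel_edges_def)
  qed
  moreover have "is_flag K" using ws by (simp add: weakly_systolic_def)
  ultimately obtain \<sigma> where "\<sigma> \<in> K" "A \<subseteq> \<sigma>"
    using assms(1) unfolding is_flag_def by meson
  then show ?thesis using ws by (auto simp: weakly_systolic_def abstract_simplicial_complex_def)
qed

lemma skel_dist_sym_le:
  assumes "u \<in> sc_vertices K" "v \<in> sc_vertices K"
  shows "skel_dist K v u \<le> skel_dist K u v"
proof -
  have "(y, x) \<in> skel_edges K ^^ n" if "(x, y) \<in> skel_edges K ^^ n" for x y n
    using that by (induction n arbitrary: y) (auto intro: relpow_Suc_I2 skel_edges_sym simp del: relpow.simps(2) elim!: relpow_Suc_E)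
  then show ?thesis using skel_dist_path[OF assms] by (blast intro: skel_dist_le)
qed

lemma skel_dist_tri:
  assumes "x \<in> sc_vertices K" "y \<in> sc_vertices K" "z \<in> sc_vertices K"
  shows "skel_dist K x z \<le> skel_dist K x y + skel_dist K y z"
  using skel_dist_path[OF assms(1,2)] skel_dist_path[OF assms(2,3)]
  by (intro skel_dist_le) (auto simp: relpow_add)

text \<open>Flagness turns the set \<open>A\<close> of \<open>proj_nonempty\<close> into a simplex
  to which weak systolicity applies; \<open>proj_clique\<close> is the case of a single
  vertex.\<close>

lemma projection_metric_skel: "projection_metric (sc_vertices K) (skel_dist K)"
proof
  let ?V = "sc_vertices K" and ?d = "skel_dist K"
  have proj: "{w \<in> skel_ball K i v. \<forall>u\<in>\<sigma>. (w, u) \<in> skel_edges K} \<noteq> {} \<and>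
      {w \<in> skel_ball K i v. \<forall>u\<in>\<sigma>. (w, u) \<in> skel_edges K} \<in> K"
    if "v \<in> ?V" "\<sigma> \<in> K" "\<sigma> \<noteq> {}" "\<sigma> \<subseteq> skel_sphere K (Suc i) v" for v i \<sigma>
    using ws that unfolding weakly_systolic_def Let_def by simp
  show "?d x y = 0 \<longleftrightarrow> x = y" if "x \<in> ?V" "y \<in> ?V" for x y
  proof
    show "?d x y = 0 \<Longrightarrow> x = y" using skel_dist_path[OF that] by simp
    show "x = y \<Longrightarrow> ?d x y = 0" using skel_dist_le[of x y 0] by simp
  qed
  show "?d x y = ?d y x" if "x \<in> ?V" "y \<in> ?V" for x y
    using skel_dist_sym_le that by (simp add: antisym)
  show "?d x z \<le> ?d x y + ?d y z" if "x \<in> ?V" "y \<in> ?V" "z \<in> ?V" for x y z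
    using skel_dist_tri that .
  show "\<exists>w\<in>?V. ?d v w = i \<and> (\<forall>x\<in>A. ?d w x = 1)"
    if A: "v \<in> ?V" "A \<subseteq> ?V" "A \<noteq> {}" "\<forall>x\<in>A. ?d v x = Suc i" "\<forall>x\<in>A. \<forall>y\<in>A. ?d x y \<le> 1" for v A i
  proof -
    have "A \<in> K" using clique_is_simplex A by blast
    moreover have "A \<subseteq> skel_sphere K (Suc i) v" using A by (auto simp: skel_sphere_def)
    ultimately obtain w where w: "w \<in> skel_ball K i v" "\<forall>u\<in>A. (w, u) \<in> skel_edges K"
      using proj[of v A i] A by blast
    then have wV: "w \<in> ?V" "?d v w \<le> i" by (auto simp: skel_ball_def)
    have wx: "?d w x = 1" if "x \<in> A" for x using that w wV A skel_dist_1_iff by blast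
    obtain x where "x \<in> A" using A by blast
    \<comment> \<open>The ball only bounds the distance from \<open>v\<close> to \<open>w\<close> by
      \<open>i\<close>; the path on to \<open>x\<close> excludes smaller values.\<close>
    then have "Suc i \<le> ?d v w + 1" using skel_dist_tri[of v w x] A wV wx by force
    then show ?thesis using wV wx by auto
  qed
  show "?d y z \<le> 1"
    if h: "v \<in> ?V" "x \<in> ?V" "y \<in> ?V" "z \<in> ?V" "?d v x = Suc i" "?d v y = i" "?d v z = i"
      "?d y x = 1" "?d z x = 1" for v x y z i
  proof -
    have "{x} \<in> K" using clique_is_simplex[of "{x}"] h skel_dist_le[of x x 0] by simp
    moreover have "{x} \<subseteq> skel_sphere K (Suc i) v" using h by (auto simp: skel_sphere_def)
    ultimately have "{w \<in> skel_ball K i v. \<forall>u\<in>{x}. (w, u) \<in> skel_edges K} \<in> K"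
      using proj[of v "{x}" i] h by blast
    moreover have "{y, z} \<subseteq> {w \<in> skel_ball K i v. \<forall>u\<in>{x}. (w, u) \<in> skel_edges K}"
      using h skel_dist_1_iff by (auto simp: skel_ball_def)
    ultimately have yz: "{y, z} \<in> K"
      using ws unfolding weakly_systolic_def abstract_simplicial_complex_def by blast
    show ?thesis
    proof (cases "y = z")
      case True
      then show ?thesis using skel_dist_le[of y z 0] by simp
    next
      case False
      then show ?thesis using yz skel_dist_le[of y z 1] by (simp add: skel_edges_def)
    qed
  qed
qed

lemma finite_skel_ball:
  assumes "sc_locally_finite K" "v \<in> sc_vertices K"
  shows "finite (skel_ball K n v)"
proof -
  interpret projection_metric "sc_vertices K" "skel_dist K" by (rule projection_metric_skel)
  show ?thesis
  proof (induction n)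
    case 0
    have "skel_ball K 0 v \<subseteq> {v}" using dist_0[of v] assms(2) by (auto simp: skel_ball_def)
    then show ?case using finite_subset by blast
  next
    case (Suc n)
    have "skel_ball K (Suc n) v \<subseteq> skel_ball K n v \<union> (\<Union>w\<in>skel_ball K n v. \<Union>{\<sigma> \<in> K. w \<in> \<sigma>})"
    proof
      fix x assume x: "x \<in> skel_ball K (Suc n) v"
      show "x \<in> skel_ball K n v \<union> (\<Union>w\<in>skel_ball K n v. \<Union>{\<sigma> \<in> K. w \<in> \<sigma>})"
      proof (cases "skel_dist K v x = Suc n")
        case True
        then obtain w where w: "w \<in> sc_vertices K" "skel_dist K v w = n" "skel_dist K w x = 1"
          using proj_vertex[of v x n] assms(2) x by (auto simp: skel_ball_def)
        then have "{w, x} \<in> K"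
          using skel_dist_1_iff[of w x] x by (auto simp: skel_ball_def skel_edges_def)
        then show ?thesis using w by (auto simp: skel_ball_def)
      next
        case False
        then show ?thesis using x by (auto simp: skel_ball_def)
      qed
    qed
    moreover have "finite (\<Union>{\<sigma> \<in> K. w \<in> \<sigma>})" if "w \<in> skel_ball K n v" for w
      using assms(1) that ws
      by (auto simp: sc_locally_finite_def skel_ball_def weakly_systolic_def
          abstract_simplicial_complex_def)
    ultimately show ?case using Suc by (auto intro: finite_subset)
  qed
qed

lemma skel_dist_automorphism_le:
  assumes "simplicial_automorphism K f" "u \<in> sc_vertices K" "v \<in> sc_vertices K"
  shows "skel_dist K (f u) (f v) \<le> skel_dist K u v"
proof -
  have f: "inj_on f (sc_vertices K)"
    "\<And>\<sigma>. \<sigma> \<subseteq> sc_vertices K \<Longrightarrow> f ` \<sigma> \<in> K \<longleftrightarrow> \<sigma> \<in> K"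
    using assms(1) by (auto simp: simplicial_automorphism_def bij_betw_def)
  have edge: "(f x, f y) \<in> skel_edges K" if e: "(x, y) \<in> skel_edges K" for x y
    using e skel_edges_vertices[OF e] f(2)[of "{x, y}"] inj_onD[OF f(1)]
    by (auto simp: skel_edges_def)
  have "(f x, f y) \<in> skel_edges K ^^ n" if "(x, y) \<in> skel_edges K ^^ n" for x y n
    using that by (induction n arbitrary: y) (auto intro: edge)
  then show ?thesis using skel_dist_path[OF assms(2,3)] by (blast intro: skel_dist_le)
qed

end

section \<open>The invariant simplex inside a finite intersection of balls\<close>

theorem theoremC:
  fixes G :: "('g, 'b) monoid_scheme"
    and K :: "'a set set"
    and \<phi> :: "'g \<Rightarrow> 'a \<Rightarrow> 'a"
  assumes "group G"
    and "finite (carrier G)"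
    and "weakly_systolic K"
    and "sc_locally_finite K"
    and "acts_by_simplicial_automorphisms G K \<phi>"
  shows "\<exists>\<sigma>\<in>K. \<sigma> \<noteq> {} \<and> (\<forall>g\<in>carrier G. \<phi> g ` \<sigma> = \<sigma>)"
proof -
  let ?V = "sc_vertices K" and ?d = "skel_dist K"
  interpret group G by fact
  interpret projection_metric ?V ?d by (rule projection_metric_skel) fact
  interpret group_action G ?V \<phi>
    using assms(5) by (simp add: acts_by_simplicial_automorphisms_def)
  have closed: "\<phi> g x \<in> ?V" if "g \<in> carrier G" "x \<in> ?V" for g x
    using element_image[OF that] by simp
  have inv: "\<phi> (inv\<^bsub>G\<^esub> g) (\<phi> g x) = x" if "g \<in> carrier G" "x \<in> ?V" for g x
    using orbit_sym_aux[OF that] by simp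
  have le: "?d (\<phi> g x) (\<phi> g y) \<le> ?d x y" if "g \<in> carrier G" "x \<in> ?V" "y \<in> ?V" for g x y
    using skel_dist_automorphism_le[OF assms(3) _ that(2,3), of "\<phi> g"] assms(5) that(1)
    by (simp add: acts_by_simplicial_automorphisms_def)
  \<comment> \<open>The reverse inequality is \<open>le\<close> for the inverse of
    \<open>g\<close>.\<close>
  have iso: "?d (\<phi> g x) (\<phi> g y) = ?d x y" if "g \<in> carrier G" "x \<in> ?V" "y \<in> ?V" for g x y
    using le[OF that] le[of "inv\<^bsub>G\<^esub> g" "\<phi> g x" "\<phi> g y"] inv closed that by simp
  obtain v where v: "v \<in> ?V" using assms(3) by (auto simp: weakly_systolic_def)
  define B where "B = (\<lambda>g. \<phi> g v) ` carrier G"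
  \<comment> \<open>With this radius, \<open>v\<close> lies in the ball around each point of its
    orbit \<open>B\<close>, so that the intersection \<open>S\<close> of these balls is
    nonempty.\<close>
  define R where "R = Max (?d v ` B)"
  have B: "finite B" "B \<subseteq> ?V"
    using assms(2) closed v by (auto simp: B_def)
  have R: "?d v x \<le> R" if "x \<in> B" for x
    unfolding R_def using B(1) that by (intro Max_ge) auto
  define S where "S = {x \<in> ?V. \<forall>c\<in>B. ?d c x \<le> R}"
  have B_act: "\<phi> g c \<in> B" if g: "g \<in> carrier G" "c \<in> B" for g c
  proof -
    obtain h where h: "h \<in> carrier G" "c = \<phi> h v" using g(2) by (auto simp: B_def)
    then have "\<phi> g c = \<phi> (g \<otimes>\<^bsub>G\<^esub> h) v" using composition_rule[OF v g(1)] by simp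
    then show ?thesis using g(1) h(1) by (auto simp: B_def)
  qed
  have "v \<in> S"
    using R B dist_sym v by (fastforce simp: S_def)
  \<comment> \<open>Being in its own orbit, \<open>v\<close> is one of the centres, so
    \<open>S\<close> lies in a ball around \<open>v\<close>, which is finite by local
    finiteness.\<close>
  have "\<phi> \<one>\<^bsub>G\<^esub> v = v" using id_eq_one v by (metis restrict_apply')
  then have "v \<in> B" unfolding B_def using one_closed by (metis imageI)
  then have "S \<subseteq> skel_ball K R v" by (auto simp: S_def skel_ball_def)
  then have "finite S" using finite_skel_ball[OF assms(3,4) v] finite_subset by blast
  have S_act: "\<phi> g ` S \<subseteq> S" if g: "g \<in> carrier G" for g
  proof
    fix z assume "z \<in> \<phi> g ` S"
    then obtain x where x: "x \<in> S" "z = \<phi> g x" by blast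
    have "?d c z \<le> R" if c: "c \<in> B" for c
    proof -
      \<comment> \<open>Moving back by the inverse of \<open>g\<close> replaces the centre
        \<open>c\<close> by another point of the orbit.\<close>
      have "?d c z = ?d (\<phi> (inv\<^bsub>G\<^esub> g) c) x"
        using iso[of "inv\<^bsub>G\<^esub> g" c z] inv[of g x] g c x B closed by (auto simp: S_def)
      then show ?thesis using B_act[of "inv\<^bsub>G\<^esub> g" c] g c x by (simp add: S_def)
    qed
    then show "z \<in> S" using x closed g by (auto simp: S_def)
  qed
  have "S \<noteq> {}" using \<open>v \<in> S\<close> by blast
  have S_proj: "projection_metric S ?d"
  proof (rule projection_metric_convex)
    fix a w u
    assume h: "a \<in> S" "w \<in> ?V" "u \<in> S" "?d w u = 1" "?d a u = Suc (?d a w)"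
    then show "w \<in> S"
      using ball_convex[of _ a w u R "?d a w"] B(2) by (auto simp: S_def)
  qed (auto simp: S_def)
  have S_image: "h ` S = S" if h: "h \<in> \<phi> ` carrier G" for h
  proof -
    obtain g where g: "g \<in> carrier G" and h_eq: "h = \<phi> g" using h by blast
    have "inj_on (\<phi> g) S" using inv[OF g] by (intro inj_on_inverseI[of _ "\<phi> (inv\<^bsub>G\<^esub> g)"]) (simp add: S_def)
    then show ?thesis unfolding h_eq by (rule endo_inj_surj[OF \<open>finite S\<close> S_act[OF g]])
  qed
  have S_iso: "?d (h x) (h y) = ?d x y" if "h \<in> \<phi> ` carrier G" "x \<in> S" "y \<in> S" for h x y
    using that iso by (auto simp: S_def)
  have "\<exists>A\<subseteq>S. A \<noteq> {} \<and> (\<forall>x\<in>A. \<forall>y\<in>A. ?d x y \<le> 1) \<and> (\<forall>h\<in>\<phi> ` carrier G. h ` A = A)"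
    by (rule invariant_clique_exists[OF \<open>finite S\<close> \<open>S \<noteq> {}\<close> S_proj S_image S_iso])
  then obtain A where A: "A \<subseteq> S" "A \<noteq> {}" "\<forall>x\<in>A. \<forall>y\<in>A. ?d x y \<le> 1"
    and A_image: "\<forall>h\<in>\<phi> ` carrier G. h ` A = A"
    by meson
  have "A \<in> K" using clique_is_simplex[OF assms(3), of A] A by (auto simp: S_def)
  then show ?thesis using A(2) A_image by blast
qed

end
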